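(* Let $K$ be a nonempty closed and convex subset of a uniformly convex hyperbolic space $X$ with monotone modulus of uniform convexity $\eta$, and let $T_i:K\to K$, $i=1,\dots,m$, be a finite family of uniformly continuous total asymptotically nonexpansive mappings with sequences $\{k_{in}\}_{n\ge1}$, $\{\varphi_{in}\}_{n\ge1}$ and functions $\xi_i$, such that $F:=\bigcap_{i=1}^mF(T_i)\ne\emptyset$. Suppose that for each $i=1,\dots,m$: (C1) $\sum_{n=1}^\infty k_{in}<\infty$ and $\sum_{n=1}^\infty\varphi_{in}<\infty$; (C2) there exist constants $M_i,M_i^*>0$ such that $\xi_i(\lambda)\le M_i^*\lambda$ for all $\lambda\ge M_i$. Let $\{\alpha_n\}_{n\ge1}$ be a sequence in $[0,1]$ bounded away from $0$ and $1$, let $x_1\in K$ and let $\{x_n\}$ be defined, for $n\ge1$, by $x_{n+1}=W(x_n,T_1^nx_n,\alpha_n)$ if $m=1$, and, if $m\ge2$, by $$x_{n+1}=W(x_n,T_1^ny_{1n},\alpha_n),\quad y_{jn}=W(x_n,T_{j+1}^ny_{(j+1)n},\alpha_n)\ (1\le j\le m-2),\quad y_{(m-1)n}=W(x_n,T_m^nx_n,\alpha_n).$$ Then $\{x_n\}$ $\triangle$-converges to a common fixed point in $F$.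
   Context: A hyperbolic space (in the sense of Kohlenbach) is a metric space $(X,d)$ together with a mapping $W:X^2\times[0,1]\to X$ such that for all $u,x,y,z,w\in X$ and $\alpha,\beta\in[0,1]$: (W1) $d(u,W(x,y,\alpha))\le(1-\alpha)d(u,x)+\alpha d(u,y)$; (W2) $d(W(x,y,\alpha),W(x,y,\beta))=|\alpha-\beta|\,d(x,y)$; (W3) $W(x,y,\alpha)=W(y,x,1-\alpha)$; (W4) $d(W(x,z,\alpha),W(y,w,\alpha))\le(1-\alpha)d(x,y)+\alpha d(z,w)$. A subset $K\subseteq X$ is convex if $W(x,y,\alpha)\in K$ for all $x,y\in K$, $\alpha\in[0,1]$. $(X,d,W)$ is uniformly convex if for all $r>0$ and $\epsilon\in(0,2]$ there is $\delta\in(0,1]$ such that for all $u,x,y\in X$ with $d(x,u)\le r$, $d(y,u)\le r$ and $d(x,y)\ge\epsilon r$ one has $d(W(x,y,\tfrac12),u)\le(1-\delta)r$. A function $\eta:(0,\infty)\times(0,2]\to(0,1]$ giving such a $\delta=\eta(r,\epsilon)$ for every $r,\epsilon$ is a modulus of uniform convexity; it is monotone if $\eta(r_2,\epsilon)\le\eta(r_1,\epsilon)$ whenever $r_2\ge r_1>0$ and $\epsilon\in(0,2]$. A mapping $T:K\to K$ is total asymptotically nonexpansive, with sequences $\{k_n\},\{\varphi_n\}$ and function $\xi$, if $\{k_n\},\{\varphi_n\}$ are nonnegative real sequences with $k_n\to0$, $\varphi_n\to0$ and $\xi:\mathbb{R}^+\to\mathbb{R}^+$ (where $\mathbb{R}^+=[0,\infty)$)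 is a strictly increasing continuous function with $\xi(0)=0$ such that $d(T^nx,T^ny)\le d(x,y)+k_n\xi(d(x,y))+\varphi_n$ for all $x,y\in K$ and $n\ge1$. $F(T)$ denotes the set of fixed points of $T$. "Bounded away from $0$ and $1$" means there are $a,b\in(0,1)$ with $\alpha_n\in[a,b]$ for all $n$. For a bounded sequence $\{x_n\}$ in $X$ and $x\in X$ put $r(x,\{x_n\})=\limsup_{n\to\infty}d(x,x_n)$. The asymptotic center of $\{x_n\}$ with respect to $K\subseteq X$ is $A_K(\{x_n\})=\{x\in K: r(x,\{x_n\})\le r(y,\{x_n\})\text{ for all }y\in K\}$. A bounded sequence $\{x_n\}$ in $K$ $\triangle$-converges to $x$ if $x$ is the unique asymptotic center of $\{u_n\}$, i.e. $A_K(\{u_n\})=\{x\}$, for every subsequence $\{u_n\}$ of $\{x_n\}$.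
   Formalization: The uniformly convex hyperbolic space X is additionally assumed to be complete; without completeness asymptotic centers may fail to exist and the claim is false, e.g. for a nonexpansive linear map on an incomplete inner product space. *)

theory Defs
  imports "HOL-Analysis.Analysis"
begin

text \<open>The space \<open>X\<close> is a type of class \<^class>\<open>metric_space\<close>. The map \<open>W\<close> is a total function, but
  only its values for parameters in \<open>[0,1]\<close> are constrained or used.\<close>

locale hyperbolic_space =
  fixes W :: "'a::metric_space \<Rightarrow> 'a \<Rightarrow> real \<Rightarrow> 'a"
  assumes W1: "\<alpha> \<in> {0..1} \<Longrightarrow> dist u (W x y \<alpha>) \<le> (1 - \<alpha>) * dist u x + \<alpha> * dist u y"
    and W2: "\<alpha> \<in> {0..1} \<Longrightarrow> \<beta> \<in> {0..1} \<Longrightarrow> dist (W x y \<alpha>) (W x y \<beta>) = \<bar>\<alpha> - \<beta>\<bar> * dist x y"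
    and W3: "\<alpha> \<in> {0..1} \<Longrightarrow> W x y \<alpha> = W y x (1 - \<alpha>)"
    and W4: "\<alpha> \<in> {0..1} \<Longrightarrow>
      dist (W x z \<alpha>) (W y w \<alpha>) \<le> (1 - \<alpha>) * dist x y + \<alpha> * dist z w"

definition W_convex :: "('a \<Rightarrow> 'a \<Rightarrow> real \<Rightarrow> 'a) \<Rightarrow> 'a set \<Rightarrow> bool" where
  "W_convex W K \<longleftrightarrow> (\<forall>x\<in>K. \<forall>y\<in>K. \<forall>\<alpha>\<in>{0..1}. W x y \<alpha> \<in> K)"

definition uniform_convexity_at ::
    "('a::metric_space \<Rightarrow> 'a \<Rightarrow> real \<Rightarrow> 'a) \<Rightarrow> real \<Rightarrow> real \<Rightarrow> real \<Rightarrow> bool" where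
  "uniform_convexity_at W r \<epsilon> \<delta> \<longleftrightarrow>
     \<delta> \<in> {0<..1} \<and>
     (\<forall>u x y. dist x u \<le> r \<longrightarrow> dist y u \<le> r \<longrightarrow> dist x y \<ge> \<epsilon> * r \<longrightarrow>
        dist (W x y (1/2)) u \<le> (1 - \<delta>) * r)"

definition uniformly_convex :: "('a::metric_space \<Rightarrow> 'a \<Rightarrow> real \<Rightarrow> 'a) \<Rightarrow> bool" where
  "uniformly_convex W \<longleftrightarrow>
     (\<forall>r>0. \<forall>\<epsilon>\<in>{0<..2}. \<exists>\<delta>. uniform_convexity_at W r \<epsilon> \<delta>)"

definition modulus_of_uniform_convexity ::
    "('a::metric_space \<Rightarrow> 'a \<Rightarrow> real \<Rightarrow> 'a) \<Rightarrow> (real \<Rightarrow> real \<Rightarrow> real) \<Rightarrow> bool" where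
  "modulus_of_uniform_convexity W \<eta> \<longleftrightarrow>
     (\<forall>r>0. \<forall>\<epsilon>\<in>{0<..2}. uniform_convexity_at W r \<epsilon> (\<eta> r \<epsilon>))"

definition monotone_modulus :: "(real \<Rightarrow> real \<Rightarrow> real) \<Rightarrow> bool" where
  "monotone_modulus \<eta> \<longleftrightarrow>
     (\<forall>r1 r2. \<forall>\<epsilon>\<in>{0<..2}. 0 < r1 \<longrightarrow> r1 \<le> r2 \<longrightarrow> \<eta> r2 \<epsilon> \<le> \<eta> r1 \<epsilon>)"

text \<open>All sequences of the iteration are indexed from 1; their values at index 0 are irrelevant.\<close>

definition total_asymptotically_nonexpansive ::
    "'a::metric_space set \<Rightarrow> ('a \<Rightarrow> 'a) \<Rightarrow> (nat \<Rightarrow> real) \<Rightarrow> (nat \<Rightarrow> real) \<Rightarrow> (real \<Rightarrow> real) \<Rightarrow> bool" where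
  "total_asymptotically_nonexpansive K T k \<phi> \<xi> \<longleftrightarrow>
     T \<in> K \<rightarrow> K \<and>
     (\<forall>n\<ge>1. 0 \<le> k n) \<and> (\<forall>n\<ge>1. 0 \<le> \<phi> n) \<and> k \<longlonglongrightarrow> 0 \<and> \<phi> \<longlonglongrightarrow> 0 \<and>
     \<xi> \<in> {0..} \<rightarrow> {0..} \<and> strict_mono_on {0..} \<xi> \<and> continuous_on {0..} \<xi> \<and> \<xi> 0 = 0 \<and>
     (\<forall>x\<in>K. \<forall>y\<in>K. \<forall>n\<ge>1.
        dist ((T ^^ n) x) ((T ^^ n) y) \<le> dist x y + k n * \<xi> (dist x y) + \<phi> n)"

definition fixed_points :: "'a set \<Rightarrow> ('a \<Rightarrow> 'a) \<Rightarrow> 'a set" where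
  "fixed_points K T = {x \<in> K. T x = x}"

definition asymptotic_radius :: "'a::metric_space \<Rightarrow> (nat \<Rightarrow> 'a) \<Rightarrow> ereal" where
  "asymptotic_radius x u = limsup (\<lambda>n. ereal (dist x (u n)))"

definition asymptotic_center :: "'a::metric_space set \<Rightarrow> (nat \<Rightarrow> 'a) \<Rightarrow> 'a set" where
  "asymptotic_center K u = {x \<in> K. \<forall>y\<in>K. asymptotic_radius x u \<le> asymptotic_radius y u}"

definition delta_converges :: "'a::metric_space set \<Rightarrow> (nat \<Rightarrow> 'a) \<Rightarrow> 'a \<Rightarrow> bool" where
  "delta_converges K u x \<longleftrightarrow>
     range u \<subseteq> K \<and> bounded (range u) \<and>
     (\<forall>s. strict_mono s \<longrightarrow> asymptotic_center K (u \<circ> s) = {x})"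

definition iteration_scheme ::
    "('a \<Rightarrow> 'a \<Rightarrow> real \<Rightarrow> 'a) \<Rightarrow> nat \<Rightarrow> (nat \<Rightarrow> 'a \<Rightarrow> 'a) \<Rightarrow> (nat \<Rightarrow> real) \<Rightarrow>
     (nat \<Rightarrow> 'a) \<Rightarrow> (nat \<Rightarrow> nat \<Rightarrow> 'a) \<Rightarrow> bool" where
  "iteration_scheme W m T \<alpha> x y \<longleftrightarrow>
     (m = 1 \<longrightarrow> (\<forall>n\<ge>1. x (n + 1) = W (x n) ((T 1 ^^ n) (x n)) (\<alpha> n))) \<and>
     (m \<ge> 2 \<longrightarrow> (\<forall>n\<ge>1.
        x (n + 1) = W (x n) ((T 1 ^^ n) (y 1 n)) (\<alpha> n) \<and>
        (\<forall>j\<in>{1..m - 2}. y j n = W (x n) ((T (j + 1) ^^ n) (y (j + 1) n)) (\<alpha> n)) \<and>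
        y (m - 1) n = W (x n) ((T m ^^ n) (x n)) (\<alpha> n)))"

end

theory Submission
  imports Defs
begin

text \<open>Under the growth condition on the \<open>\<xi>\<^sub>i\<close>, each power satisfies
  \<open>d(T\<^sub>i\<^sup>n u, T\<^sub>i\<^sup>n v) \<le> (1 + A\<^sub>n) d(u,v) + B\<^sub>n\<close> with summable \<open>A\<close>, \<open>B\<close>. Hence \<open>d(x\<^sub>n,p)\<close> satisfies a
  summably perturbed monotone recursion and converges for every common fixed point \<open>p\<close>, and each
  intermediate iterate has the same limiting distance to \<open>p\<close>. Uniform convexity then forces the two
  end points of every \<open>W\<close>-segment of the scheme together, which gives \<open>d(x\<^sub>n, T\<^sub>i x\<^sub>n) \<rightarrow> 0\<close>.

  Points nearly minimising the asymptotic radius of a bounded sequence are close to each other. So the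
  asymptotic center of a subsequence is a single point \<open>v\<close>, and \<open>T\<^sub>i\<^sup>n v \<rightarrow> v\<close> because \<open>T\<^sub>i\<^sup>n v\<close> is a
  minimising sequence; thus \<open>v\<close> is a common fixed point. As \<open>d(x\<^sub>n,v)\<close> converges for such \<open>v\<close>, the
  asymptotic radius of \<open>v\<close> is the same for all subsequences, and the centers coincide.\<close>

section \<open>Perturbed real recursions and bounds on the asymptotic radius\<close>

text \<open>Dividing by the partial products \<open>P n\<close> of \<open>1 + A i\<close> removes
  the multiplicative perturbation, and subtracting the partial sums of \<open>B\<close> removes the
  additive one. What is left decreases and is bounded below by \<open>- suminf B\<close>. As
  \<open>P\<close> increases and stays below \<open>exp (suminf A)\<close>, the normalisation can be
  undone in the limit.\<close>

lemma perturbed_recursion_convergent: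
  fixes a A B :: "nat \<Rightarrow> real"
  assumes nonneg: "\<And>n. 0 \<le> a n" "\<And>n. 0 \<le> A n" "\<And>n. 0 \<le> B n"
    and summable: "summable A" "summable B"
    and step: "\<And>n. a (Suc n) \<le> (1 + A n) * a n + B n"
  shows "convergent a"
proof -
  define P where "P n = (\<Prod>i<n. 1 + A i)" for n
  have P_Suc: "P (Suc n) = (1 + A n) * P n" for n
    by (simp add: P_def mult.commute)
  have P_ge: "1 \<le> P n" for n
    unfolding P_def using nonneg(2) by (intro prod_ge_1) simp
  have P_mono: "incseq P"
  proof (rule incseq_SucI)
    show "P n \<le> P (Suc n)" for n
      using P_ge[of n] nonneg(2)[of n] by (simp add: P_Suc mult_le_cancel_right1)
  qed
  have P_le: "P n \<le> exp (suminf A)" for n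
  proof -
    have "P n \<le> (\<Prod>i<n. exp (A i))"
      unfolding P_def using nonneg(2) by (intro prod_mono) (auto intro: add_nonneg_nonneg)
    also have "\<dots> = exp (\<Sum>i<n. A i)"
      by (simp add: exp_sum)
    also have "\<dots> \<le> exp (suminf A)"
      using sum_le_suminf[OF summable(1)] nonneg(2) by auto
    finally show ?thesis .
  qed
  obtain LP where LP: "P \<longlonglongrightarrow> LP"
    using incseq_convergent[OF P_mono] P_le by blast
  define D where "D n = a n / P n - (\<Sum>i<n. B i)" for n
  have "decseq D"
  proof (rule decseq_SucI)
    fix n
    have "a (Suc n) / P (Suc n) \<le> ((1 + A n) * a n + B n) / P (Suc n)"
      using step[of n] P_ge[of "Suc n"] by (intro divide_right_mono) auto
    also have "\<dots> = a n / P n + B n / P (Suc n)"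
      using nonneg(2)[of n] P_ge[of n] by (simp add: P_Suc add_divide_distrib)
    also have "\<dots> \<le> a n / P n + B n"
      using nonneg(3)[of n] P_ge[of "Suc n"] by (simp add: divide_le_eq mult_le_cancel_left1)
    finally show "D (Suc n) \<le> D n"
      by (simp add: D_def)
  qed
  moreover have "- suminf B \<le> D n" for n
  proof -
    have "(\<Sum>i<n. B i) \<le> suminf B"
      using sum_le_suminf[OF summable(2)] nonneg(3) by auto
    moreover have "0 \<le> a n / P n"
      using nonneg(1)[of n] P_ge[of n] by simp
    ultimately show ?thesis
      by (simp add: D_def)
  qed
  ultimately obtain LD where LD: "D \<longlonglongrightarrow> LD"
    using decseq_convergent by blast
  have "(\<lambda>n. (D n + (\<Sum>i<n. B i)) * P n) \<longlonglongrightarrow> (LD + suminf B) * LP"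
    by (intro tendsto_intros LD LP summable_LIMSEQ summable)
  moreover have "(D n + (\<Sum>i<n. B i)) * P n = a n" for n
    using P_ge[of n] by (simp add: D_def)
  ultimately show ?thesis
    by (auto simp: convergent_def)
qed

text \<open>Trades the extended-real limsup for eventual inequalities between reals, to which
  triangle inequalities apply directly.\<close>

lemma asymptotic_radius_le_iff:
  "asymptotic_radius y u \<le> ereal c \<longleftrightarrow> (\<forall>e>0. \<forall>\<^sub>F n in sequentially. dist y (u n) < c + e)"
  unfolding asymptotic_radius_def Limsup_le_iff
proof safe
  fix e :: real
  assume *: "\<forall>b>ereal c. \<forall>\<^sub>F n in sequentially. ereal (dist y (u n)) < b" and "0 < e"
  then show "\<forall>\<^sub>F n in sequentially. dist y (u n) < c + e"
    using *[rule_format, of "ereal (c + e)"] by simp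
next
  fix b :: ereal
  assume *: "\<forall>e>0. \<forall>\<^sub>F n in sequentially. dist y (u n) < c + e" and "ereal c < b"
  then show "\<forall>\<^sub>F n in sequentially. ereal (dist y (u n)) < b"
  proof (cases b)
    case (real r)
    then show ?thesis
      using *[rule_format, of "r - c"] \<open>ereal c < b\<close> by simp
  qed auto
qed

section \<open>Uniform convexity estimates along \<open>W\<close>-segments\<close>

lemma (in hyperbolic_space)
  assumes "\<alpha> \<in> {0..1}"
  shows dist_W_left: "dist x (W x y \<alpha>) \<le> \<alpha> * dist x y"
    and dist_W_right: "dist y (W x y \<alpha>) \<le> (1 - \<alpha>) * dist x y"
  using W1[OF assms, of x x y] W1[OF assms, of y x y] by (auto simp: dist_commute)

locale uniformly_convex_hyperbolic_space = hyperbolic_space W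
  for W :: "'a::metric_space \<Rightarrow> 'a \<Rightarrow> real \<Rightarrow> 'a" +
  fixes \<eta> :: "real \<Rightarrow> real \<Rightarrow> real"
  assumes modulus: "modulus_of_uniform_convexity W \<eta>"
    and monotone: "monotone_modulus \<eta>"
begin

lemma modulus_pos: "0 < r \<Longrightarrow> \<epsilon> \<in> {0<..2} \<Longrightarrow> 0 < \<eta> r \<epsilon> \<and> \<eta> r \<epsilon> \<le> 1"
  using modulus by (auto simp: modulus_of_uniform_convexity_def uniform_convexity_at_def)

lemma dist_midpoint_le:
  assumes "0 < r" "\<epsilon> \<in> {0<..2}" "dist x u \<le> r" "dist y u \<le> r" "\<epsilon> * r \<le> dist x y"
  shows "dist (W x y (1/2)) u \<le> (1 - \<eta> r \<epsilon>) * r"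
  using modulus assms by (auto simp: modulus_of_uniform_convexity_def uniform_convexity_at_def)

text \<open>The midpoint of two different candidates would be strictly closer to \<open>x\<close>
  and no farther from \<open>y\<close> than allowed, so its distances to \<open>x\<close> and
  \<open>y\<close> would add up to less than \<open>dist x y\<close>.\<close>

lemma geodesic_point_unique:
  fixes w w' x y :: 'a
  assumes \<alpha>: "\<alpha> \<in> {0..1}"
    and w: "dist x w \<le> \<alpha> * dist x y" "dist y w \<le> (1 - \<alpha>) * dist x y"
    and w': "dist x w' \<le> \<alpha> * dist x y" "dist y w' \<le> (1 - \<alpha>) * dist x y"
  shows "w = w'"
proof (rule ccontr)
  assume "w \<noteq> w'"
  define r where "r = \<alpha> * dist x y"
  define v where "v = W w w' (1/2)"
  have tri: "dist w w' \<le> 2 * r"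
    using w(1) w'(1) dist_triangle[of w w' x] by (simp add: r_def dist_commute)
  then have r: "0 < r"
    using \<open>w \<noteq> w'\<close> zero_less_dist_iff[of w w'] by linarith
  \<comment> \<open>The largest separation parameter that \<open>dist_midpoint_le\<close> admits for
    \<open>w\<close> and \<open>w'\<close> in the ball of radius \<open>r\<close> about
    \<open>x\<close>.\<close>
  let ?\<epsilon> = "dist w w' / r"
  have \<epsilon>: "?\<epsilon> \<in> {0<..2}"
    using r tri \<open>w \<noteq> w'\<close> by (auto simp: divide_le_eq)
  have "dist v x \<le> (1 - \<eta> r ?\<epsilon>) * r"
    unfolding v_def using w(1) w'(1) r
    by (intro dist_midpoint_le \<epsilon>) (auto simp: r_def dist_commute)
  also have "\<dots> < r"
    using modulus_pos[OF r \<epsilon>] r by simp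
  finally have "dist x v < \<alpha> * dist x y"
    by (simp add: r_def dist_commute)
  moreover have "dist y v \<le> (1 - \<alpha>) * dist x y"
    using W1[of "1/2" y w w'] w(2) w'(2) by (simp add: v_def)
  ultimately have "dist x v + dist y v < dist x y"
    by (simp add: algebra_simps)
  then show False
    using dist_triangle[of x y v] by (simp add: dist_commute)
qed

text \<open>Both points satisfy the distance bounds of \<open>geodesic_point_unique\<close> with
  parameter \<open>\<alpha>\<close>. This carries the midpoint estimate over to other
  parameters.\<close>

lemma W_midpoint:
  assumes "0 \<le> \<alpha>" "\<alpha> \<le> 1/2"
  shows "W x y \<alpha> = W x (W x y (1/2)) (2 * \<alpha>)"
proof (rule geodesic_point_unique)
  let ?m = "W x y (1/2)"
  have m: "dist x ?m \<le> dist x y / 2" "dist y ?m \<le> dist x y / 2"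
    using dist_W_left[of "1/2" x y] dist_W_right[of "1/2" y x] by auto
  have 2: "2 * \<alpha> \<in> {0..1}"
    using assms by simp
  show "\<alpha> \<in> {0..1}"
    using assms by simp
  then show "dist x (W x y \<alpha>) \<le> \<alpha> * dist x y" "dist y (W x y \<alpha>) \<le> (1 - \<alpha>) * dist x y"
    by (auto intro: dist_W_left dist_W_right)
  have "dist x (W x ?m (2 * \<alpha>)) \<le> 2 * \<alpha> * dist x ?m"
    by (rule dist_W_left[OF 2])
  also have "\<dots> \<le> 2 * \<alpha> * (dist x y / 2)"
    using m assms by (intro mult_left_mono) auto
  finally show "dist x (W x ?m (2 * \<alpha>)) \<le> \<alpha> * dist x y"
    by simp
  have "dist y (W x ?m (2 * \<alpha>)) \<le> (1 - 2 * \<alpha>) * dist y x + 2 * \<alpha> * dist y ?m"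
    by (rule W1[OF 2])
  also have "\<dots> \<le> (1 - 2 * \<alpha>) * dist y x + 2 * \<alpha> * (dist x y / 2)"
    using m assms by (intro add_left_mono mult_left_mono) auto
  finally show "dist y (W x ?m (2 * \<alpha>)) \<le> (1 - \<alpha>) * dist x y"
    by (simp add: algebra_simps dist_commute)
qed

text \<open>By \<open>W_midpoint\<close> the point is a combination of \<open>x\<close> and the
  midpoint with weight \<open>2 * \<alpha>\<close> on the latter, so it inherits this fraction of
  the midpoint's gain. Replacing \<open>\<alpha>\<close> by \<open>s\<close> makes the bound
  uniform.\<close>

lemma dist_W_le_half:
  assumes r: "0 < r" and \<epsilon>: "\<epsilon> \<in> {0<..2}"
    and xy: "dist x u \<le> r" "dist y u \<le> r" "\<epsilon> * r \<le> dist x y"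
    and s: "0 \<le> s" "s \<le> \<alpha>" "\<alpha> \<le> 1/2"
  shows "dist (W x y \<alpha>) u \<le> (1 - 2 * s * \<eta> r \<epsilon>) * r"
proof -
  have "dist u (W x y \<alpha>) \<le> (1 - 2 * \<alpha>) * dist u x + 2 * \<alpha> * dist u (W x y (1/2))"
    using s by (subst W_midpoint) (auto intro!: W1)
  also have "\<dots> \<le> (1 - 2 * \<alpha>) * r + 2 * \<alpha> * ((1 - \<eta> r \<epsilon>) * r)"
    using s dist_midpoint_le[OF r \<epsilon> xy] xy
    by (intro add_mono mult_left_mono) (auto simp: dist_commute)
  also have "\<dots> = (1 - 2 * \<alpha> * \<eta> r \<epsilon>) * r"
    by (simp add: algebra_simps)
  also have "\<dots> \<le> (1 - 2 * s * \<eta> r \<epsilon>) * r"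
    using s r modulus_pos[OF r \<epsilon>] by (intro mult_right_mono) (auto intro: mult_right_mono)
  finally show ?thesis
    by (simp add: dist_commute)
qed

lemma dist_W_le:
  assumes r: "0 < r" and \<epsilon>: "\<epsilon> \<in> {0<..2}"
    and xy: "dist x u \<le> r" "dist y u \<le> r" "\<epsilon> * r \<le> dist x y"
    and s: "0 \<le> s" "\<alpha> \<in> {s..1 - s}"
  shows "dist (W x y \<alpha>) u \<le> (1 - 2 * s * \<eta> r \<epsilon>) * r"
proof (cases "\<alpha> \<le> 1/2")
  case True
  then show ?thesis
    using dist_W_le_half assms by auto
next
  case False
  \<comment> \<open>With the end points exchanged by \<open>W3\<close>, the parameter
    \<open>1 - \<alpha>\<close> lies between \<open>s\<close> and 1/2.\<close>
  have "dist (W y x (1 - \<alpha>)) u \<le> (1 - 2 * s * \<eta> r \<epsilon>) * r"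
    using False s xy by (intro dist_W_le_half r \<epsilon>) (auto simp: dist_commute)
  then show ?thesis
    using W3[of \<alpha> x y] s by auto
qed

text \<open>The gap \<open>\<delta>\<close> does not depend on the points: monotonicity of the modulus allows one to replace
  \<open>\<eta> r\<close> by \<open>\<eta> (c + 1)\<close> for every radius \<open>r\<close> slightly larger than \<open>c\<close>.\<close>

lemma uniform_gap:
  assumes c: "0 \<le> c" and e: "0 < e" and s: "0 < s" "s \<le> 1/2"
  obtains \<delta> where "0 < \<delta>"
    "\<And>u x y \<alpha>. \<lbrakk>dist x u \<le> c + \<delta>; dist y u \<le> c + \<delta>; e \<le> dist x y; \<alpha> \<in> {s..1 - s}\<rbrakk>
       \<Longrightarrow> dist (W x y \<alpha>) u \<le> c - \<delta>"
proof (cases "c = 0")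
  case True
  show ?thesis
  proof
    \<comment> \<open>For \<open>c = 0\<close> this choice makes the premises contradictory: they
      would give \<open>e \<le> dist x y \<le> e / 2\<close>.\<close>
    show "0 < e / 4"
      using e by simp
    fix u x y :: 'a and \<alpha>
    assume "dist x u \<le> c + e / 4" "dist y u \<le> c + e / 4" "e \<le> dist x y"
    then show "dist (W x y \<alpha>) u \<le> c - e / 4"
      using True e dist_triangle2[of x y u] by simp
  qed
next
  case False
  then have c: "0 < c"
    using c by simp
  \<comment> \<open>The minimum keeps \<epsilon> in the domain of the modulus, and dividing by
    \<open>c + 1\<close> ensures \<open>\<epsilon> * (c + \<delta>) \<le> e\<close> whenever
    \<open>\<delta> \<le> 1\<close>.\<close>
  define \<epsilon> where "\<epsilon> = min 2 (e / (c + 1))"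
  have \<epsilon>: "\<epsilon> \<in> {0<..2}"
    using e c by (simp add: \<epsilon>_def)
  define t where "t = 2 * s * \<eta> (c + 1) \<epsilon>"
  have t: "0 < t"
    using modulus_pos[of "c + 1" \<epsilon>] c \<epsilon> s by (simp add: t_def)
  \<comment> \<open>The second bound says \<open>2 * \<delta> \<le> t * c\<close>, which gives
    \<open>(1 - t) * (c + \<delta>) \<le> c - \<delta>\<close>.\<close>
  define \<delta> where "\<delta> = min 1 (t * c / 2)"
  have \<delta>: "0 < \<delta>" "\<delta> \<le> 1" "\<delta> \<le> t * c / 2"
    using t c by (auto simp: \<delta>_def)
  show ?thesis
  proof
    show "0 < \<delta>" by fact
    fix u x y :: 'a and \<alpha>
    assume *: "dist x u \<le> c + \<delta>" "dist y u \<le> c + \<delta>" "e \<le> dist x y" "\<alpha> \<in> {s..1 - s}"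
    have "\<epsilon> * (c + \<delta>) \<le> e / (c + 1) * (c + 1)"
      using \<delta> c e by (intro mult_mono) (auto simp: \<epsilon>_def)
    then have "\<epsilon> * (c + \<delta>) \<le> dist x y"
      using * c by simp
    then have "dist (W x y \<alpha>) u \<le> (1 - 2 * s * \<eta> (c + \<delta>) \<epsilon>) * (c + \<delta>)"
      using * c \<delta> s by (intro dist_W_le \<epsilon>) auto
    also have "\<dots> \<le> (1 - t) * (c + \<delta>)"
    proof -
      have "\<eta> (c + 1) \<epsilon> \<le> \<eta> (c + \<delta>) \<epsilon>"
        using monotone \<epsilon> c \<delta> by (auto simp: monotone_modulus_def)
      then show ?thesis
        using s c \<delta> by (intro mult_right_mono) (auto simp: t_def)
    qed
    also have "\<dots> \<le> c - \<delta>"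
    proof -
      have "0 \<le> t * \<delta>"
        using t \<delta> by simp
      then show ?thesis
        using \<delta>(3) by (simp add: algebra_simps)
    qed
    finally show "dist (W x y \<alpha>) u \<le> c - \<delta>" .
  qed
qed

text \<open>The analogue of Schu's lemma for \<open>W\<close>: if \<open>x n\<close> and
  \<open>y n\<close> were \<open>e\<close> apart for a late \<open>n\<close>, then
  \<open>uniform_gap\<close> would put their combination within \<open>c - \<delta>\<close> of
  \<open>p\<close>, although its distance tends to \<open>c\<close>. An upper bound suffices for
  \<open>y\<close>, and this is what near nonexpansiveness provides.\<close>

lemma dist_tendsto_zero_of_W_tendsto:
  assumes x: "(\<lambda>n. dist (x n) p) \<longlonglongrightarrow> c"
    and y: "\<And>n. dist (y n) p \<le> b n" "b \<longlonglongrightarrow> c"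
    and W: "(\<lambda>n. dist (W (x n) (y n) (\<alpha> n)) p) \<longlonglongrightarrow> c"
    and s: "0 < s" "s \<le> 1/2" "\<And>n. \<alpha> n \<in> {s..1 - s}"
  shows "(\<lambda>n. dist (x n) (y n)) \<longlonglongrightarrow> 0"
proof (rule tendstoI)
  fix e :: real
  assume "0 < e"
  have "0 \<le> c"
    using x by (rule LIMSEQ_le_const) auto
  then obtain \<delta> where "0 < \<delta>" and \<delta>:
    "\<And>u x y \<alpha>. \<lbrakk>dist x u \<le> c + \<delta>; dist y u \<le> c + \<delta>; e \<le> dist x y; \<alpha> \<in> {s..1 - s}\<rbrakk>
       \<Longrightarrow> dist (W x y \<alpha>) u \<le> c - \<delta>"
    using uniform_gap[OF _ \<open>0 < e\<close> s(1,2)] by blast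
  have "\<forall>\<^sub>F n in sequentially. dist (x n) p < c + \<delta>"
    using order_tendstoD(2)[OF x, of "c + \<delta>"] \<open>0 < \<delta>\<close> by simp
  moreover have "\<forall>\<^sub>F n in sequentially. b n < c + \<delta>"
    using order_tendstoD(2)[OF y(2), of "c + \<delta>"] \<open>0 < \<delta>\<close> by simp
  moreover have "\<forall>\<^sub>F n in sequentially. c - \<delta> < dist (W (x n) (y n) (\<alpha> n)) p"
    using order_tendstoD(1)[OF W, of "c - \<delta>"] \<open>0 < \<delta>\<close> by simp
  ultimately show "\<forall>\<^sub>F n in sequentially. dist (dist (x n) (y n)) 0 < e"
  proof eventually_elim
    case (elim n)
    then have "\<not> e \<le> dist (x n) (y n)"
      using \<delta>[of "x n" p "y n" "\<alpha> n"] y(1)[of n] s(3)[of n] by force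
    then show ?case
      by simp
  qed
qed

section \<open>Existence and uniqueness of asymptotic centers\<close>

text \<open>The midpoint of two distant points with nearly minimal radius would, by
  \<open>uniform_gap\<close>, have radius at most \<open>\<rho> - \<delta>\<close>, below the lower
  bound \<rho>.\<close>

lemma asymptotic_radius_near_infimum:
  assumes conv: "W_convex W K" and "0 \<le> \<rho>"
    and inf: "\<And>y. y \<in> K \<Longrightarrow> ereal \<rho> \<le> asymptotic_radius y u"
    and "0 < e"
  obtains \<delta> where "0 < \<delta>"
    "\<And>y y'. \<lbrakk>y \<in> K; y' \<in> K; asymptotic_radius y u \<le> ereal (\<rho> + \<delta>);
        asymptotic_radius y' u \<le> ereal (\<rho> + \<delta>)\<rbrakk> \<Longrightarrow> dist y y' < e"
proof -
  obtain \<delta> where "0 < \<delta>" and \<delta>: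
    "\<And>u x y \<alpha>. \<lbrakk>dist x u \<le> \<rho> + \<delta>; dist y u \<le> \<rho> + \<delta>; e \<le> dist x y; \<alpha> \<in> {1/2..1 - 1/2}\<rbrakk>
       \<Longrightarrow> dist (W x y \<alpha>) u \<le> \<rho> - \<delta>"
    using uniform_gap[OF \<open>0 \<le> \<rho>\<close> \<open>0 < e\<close>, of "1/2"] by auto
  show ?thesis
  proof
    \<comment> \<open>Half of the gap is spent on the excess radius, the other half on passing from
      a limsup to an eventual bound.\<close>
    show "0 < \<delta> / 2"
      using \<open>0 < \<delta>\<close> by simp
    fix y y'
    assume K: "y \<in> K" "y' \<in> K" and
      "asymptotic_radius y u \<le> ereal (\<rho> + \<delta> / 2)" "asymptotic_radius y' u \<le> ereal (\<rho> + \<delta> / 2)"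
    then have ev: "\<forall>\<^sub>F n in sequentially. dist y (u n) < (\<rho> + \<delta> / 2) + \<delta> / 2"
      "\<forall>\<^sub>F n in sequentially. dist y' (u n) < (\<rho> + \<delta> / 2) + \<delta> / 2"
      using \<open>0 < \<delta>\<close> unfolding asymptotic_radius_le_iff by (meson half_gt_zero)+
    show "dist y y' < e"
    proof (rule ccontr)
      assume far: "\<not> dist y y' < e"
      have "\<forall>\<^sub>F n in sequentially. dist (W y y' (1/2)) (u n) \<le> \<rho> - \<delta>"
        using ev
      proof eventually_elim
        case (elim n)
        then show ?case
          using far by (intro \<delta>) auto
      qed
      then have "asymptotic_radius (W y y' (1/2)) u \<le> ereal (\<rho> - \<delta>)"
        unfolding asymptotic_radius_le_iff by (auto elim!: eventually_mono)
      moreover have "W y y' (1/2) \<in> K"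
        using conv K by (simp add: W_convex_def)
      ultimately have "ereal \<rho> \<le> ereal (\<rho> - \<delta>)"
        using inf by (meson order_trans)
      then show False
        using \<open>0 < \<delta>\<close> by simp
    qed
  qed
qed

text \<open>A minimising sequence is Cauchy by \<open>asymptotic_radius_near_infimum\<close>, and
  its limit in \<open>K\<close> attains the infimum. The last conclusion, that every minimising
  sequence converges to the center, will be applied to the orbit of \<open>v\<close> under a
  mapping.\<close>

lemma asymptotic_center_singleton:
  assumes complete: "complete (UNIV :: 'a set)"
    and K: "closed K" "W_convex W K" "K \<noteq> {}"
    and bounded: "bounded (range u)"
  obtains v \<rho> where "asymptotic_center K u = {v}" "asymptotic_radius v u = ereal \<rho>"
    "\<And>w. \<lbrakk>\<And>n. w n \<in> K; \<And>e. 0 < e \<Longrightarrow> \<forall>\<^sub>F n in sequentially. asymptotic_radius (w n) u \<le> ereal (\<rho> + e)\<rbrakk>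
       \<Longrightarrow> w \<longlonglongrightarrow> v"
proof -
  \<comment> \<open>Real upper bounds of the radii, so that the infimum is taken over reals. The set
    is nonempty because \<open>u\<close> is bounded.\<close>
  define S where "S = {c. \<exists>y\<in>K. asymptotic_radius y u \<le> ereal c}"
  define \<rho> where "\<rho> = Inf S"
  have nonneg: "0 \<le> asymptotic_radius y u" for y
    unfolding asymptotic_radius_def by (intro le_Limsup) auto
  have S_nonneg: "0 \<le> c" if "c \<in> S" for c
    using that nonneg order_trans[of 0 _ "ereal c"] by (fastforce simp: S_def)
  have "S \<noteq> {}"
  proof -
    obtain y where "y \<in> K"
      using K by blast
    obtain c where "\<forall>z\<in>range u. dist y z \<le> c"
      using bounded bounded_any_center[of "range u" y] by blast
    then have "asymptotic_radius y u \<le> ereal c"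
      unfolding asymptotic_radius_def by (intro Limsup_bounded) auto
    with \<open>y \<in> K\<close> show ?thesis
      by (auto simp: S_def)
  qed
  have bdd: "bdd_below S"
    using S_nonneg by (auto simp: bdd_below_def)
  have "0 \<le> \<rho>"
    unfolding \<rho>_def using S_nonneg \<open>S \<noteq> {}\<close> by (intro cInf_greatest) auto
  have inf: "ereal \<rho> \<le> asymptotic_radius y u" if "y \<in> K" for y
  proof (rule ccontr)
    assume "\<not> ereal \<rho> \<le> asymptotic_radius y u"
    then have "asymptotic_radius y u < ereal \<rho>"
      by simp
    then obtain c where "asymptotic_radius y u < ereal c" "c < \<rho>"
      by (auto dest: ereal_dense2)
    moreover then have "c \<in> S"
      using that by (auto simp: S_def intro: less_imp_le)
    ultimately show False
      using cInf_lower[OF _ bdd] unfolding \<rho>_def by force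
  qed
  note near = asymptotic_radius_near_infimum[OF K(2) \<open>0 \<le> \<rho>\<close> inf]
  have "\<exists>y\<in>K. asymptotic_radius y u \<le> ereal (\<rho> + inverse (real (Suc n)))" for n
  proof -
    have "\<rho> < \<rho> + inverse (real (Suc n))"
      by simp
    then obtain c where "c \<in> S" "c < \<rho> + inverse (real (Suc n))"
      using \<open>S \<noteq> {}\<close> bdd unfolding \<rho>_def by (meson cInf_lessD)
    then obtain y where "y \<in> K" "asymptotic_radius y u \<le> ereal c"
      by (auto simp: S_def)
    moreover have "ereal c \<le> ereal (\<rho> + inverse (real (Suc n)))"
      using \<open>c < _\<close> by simp
    ultimately show ?thesis
      using order_trans by blast
  qed
  then obtain y where y: "\<And>n. y n \<in> K" "\<And>n. asymptotic_radius (y n) u \<le> ereal (\<rho> + inverse (real (Suc n)))"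
    by metis
  have y_ev: "\<forall>\<^sub>F n in sequentially. asymptotic_radius (y n) u \<le> ereal (\<rho> + e)" if "0 < e" for e
  proof -
    have "\<forall>\<^sub>F n in sequentially. inverse (real (Suc n)) < e"
      using order_tendstoD(2)[OF LIMSEQ_inverse_real_of_nat that] .
    then show ?thesis
    proof eventually_elim
      case (elim n)
      then show ?case
        using y(2)[of n] by (auto intro: order_trans)
    qed
  qed
  have "Cauchy y"
  proof (rule metric_CauchyI)
    fix e :: real
    assume "0 < e"
    obtain \<delta> where "0 < \<delta>" and \<delta>: "\<And>y y'. \<lbrakk>y \<in> K; y' \<in> K; asymptotic_radius y u \<le> ereal (\<rho> + \<delta>);
        asymptotic_radius y' u \<le> ereal (\<rho> + \<delta>)\<rbrakk> \<Longrightarrow> dist y y' < e"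
      using near[OF _ \<open>0 < e\<close>] by blast
    show "\<exists>M. \<forall>m\<ge>M. \<forall>n\<ge>M. dist (y m) (y n) < e"
      using y_ev[OF \<open>0 < \<delta>\<close>] \<delta> y(1) unfolding eventually_sequentially by blast
  qed
  then obtain v where "y \<longlonglongrightarrow> v"
    using complete unfolding complete_def by blast
  have "v \<in> K"
    using K(1) y(1) \<open>y \<longlonglongrightarrow> v\<close> by (rule closed_sequentially)
  have "asymptotic_radius v u \<le> ereal \<rho>"
    unfolding asymptotic_radius_le_iff
  proof safe
    fix e :: real
    assume "0 < e"
    \<comment> \<open>One third each for the distance from \<open>y n\<close> to \<open>v\<close>,
      for the excess radius of \<open>y n\<close> and for the limsup slack.\<close>
    then have e: "0 < e / 3"
      by simp
    obtain n where n: "dist (y n) v < e / 3" "asymptotic_radius (y n) u \<le> ereal (\<rho> + e / 3)"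
      using eventually_happens[OF eventually_conj[OF tendstoD[OF \<open>y \<longlonglongrightarrow> v\<close> e] y_ev[OF e]]] by auto
    then have "\<forall>\<^sub>F k in sequentially. dist (y n) (u k) < \<rho> + e / 3 + e / 3"
      using e unfolding asymptotic_radius_le_iff by blast
    then show "\<forall>\<^sub>F k in sequentially. dist v (u k) < \<rho> + e"
    proof eventually_elim
      case (elim k)
      then show ?case
        using n(1) dist_triangle3[of v "u k" "y n"] by linarith
    qed
  qed
  then have v: "asymptotic_radius v u = ereal \<rho>"
    using inf[OF \<open>v \<in> K\<close>] by simp
  have lim: "w \<longlonglongrightarrow> v" if w: "\<And>n. w n \<in> K"
    "\<And>e. 0 < e \<Longrightarrow> \<forall>\<^sub>F n in sequentially. asymptotic_radius (w n) u \<le> ereal (\<rho> + e)" for w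
  proof (rule tendstoI)
    fix e :: real
    assume "0 < e"
    obtain \<delta> where "0 < \<delta>" and \<delta>: "\<And>y y'. \<lbrakk>y \<in> K; y' \<in> K; asymptotic_radius y u \<le> ereal (\<rho> + \<delta>);
        asymptotic_radius y' u \<le> ereal (\<rho> + \<delta>)\<rbrakk> \<Longrightarrow> dist y y' < e"
      using near[OF _ \<open>0 < e\<close>] by blast
    show "\<forall>\<^sub>F n in sequentially. dist (w n) v < e"
      using w(2)[OF \<open>0 < \<delta>\<close>]
    proof eventually_elim
      case (elim n)
      then show ?case
        using \<open>0 < \<delta>\<close> \<open>v \<in> K\<close> w(1) by (intro \<delta>) (auto simp: v)
    qed
  qed
  have "asymptotic_center K u = {v}"
  proof (intro equalityI subsetI)
    fix y
    assume "y \<in> asymptotic_center K u"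
    then have "y \<in> K" "asymptotic_radius y u \<le> ereal \<rho>"
      using \<open>v \<in> K\<close> v by (auto simp: asymptotic_center_def)
    \<comment> \<open>Any other center is a constant minimising sequence.\<close>
    then have "(\<lambda>_. y) \<longlonglongrightarrow> v"
      by (intro lim) (auto intro: order_trans)
    then show "y \<in> {v}"
      by (simp add: LIMSEQ_const_iff)
  qed (use \<open>v \<in> K\<close> inf v in \<open>auto simp: asymptotic_center_def\<close>)
  then show ?thesis
    using that v lim by blast
qed

end

section \<open>Nearly nonexpansive mappings, fixed points and Delta-convergence\<close>

text \<open>The linear form taken by total asymptotic nonexpansiveness under the growth condition.
  Index \<open>n\<close> belongs to the power \<open>Suc n\<close>, so that the error sequences
  start at 0 while only positive powers are estimated.\<close>

definition nearly_nonexpansive ::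
  "'a::metric_space set \<Rightarrow> ('a \<Rightarrow> 'a) \<Rightarrow> (nat \<Rightarrow> real) \<Rightarrow> (nat \<Rightarrow> real) \<Rightarrow> bool" where
  "nearly_nonexpansive K T A B \<longleftrightarrow> T \<in> K \<rightarrow> K \<and>
     (\<forall>u\<in>K. \<forall>v\<in>K. \<forall>n. dist ((T ^^ Suc n) u) ((T ^^ Suc n) v) \<le> (1 + A n) * dist u v + B n)"

lemma funpow_in: "T \<in> K \<rightarrow> K \<Longrightarrow> x \<in> K \<Longrightarrow> (T ^^ n) x \<in> K"
  by (induction n) auto

text \<open>Uniform continuity carries the statement for the power \<open>n\<close> to the images
  under \<open>T\<close>; the triangle inequality through \<open>T (u j)\<close> completes the
  induction.\<close>

lemma approximate_fixed_points_funpow: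
  fixes u :: "nat \<Rightarrow> 'a::metric_space"
  assumes "T \<in> K \<rightarrow> K" "uniformly_continuous_on K T" "\<And>j. u j \<in> K"
    and lim: "(\<lambda>j. dist (u j) (T (u j))) \<longlonglongrightarrow> 0"
  shows "(\<lambda>j. dist (u j) ((T ^^ n) (u j))) \<longlonglongrightarrow> 0"
proof (induction n)
  case (Suc n)
  have "(\<lambda>j. dist (T (u j)) (T ((T ^^ n) (u j)))) \<longlonglongrightarrow> 0"
    using assms(2)[unfolded uniformly_continuous_on_sequentially, rule_format, of u "\<lambda>j. (T ^^ n) (u j)"]
      Suc assms(1,3) funpow_in[of T K] by blast
  from tendsto_add[OF lim this] have "(\<lambda>j. dist (u j) (T (u j)) + dist (T (u j)) ((T ^^ Suc n) (u j))) \<longlonglongrightarrow> 0"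
    by simp
  then show ?case
    by (rule tendsto_sandwich[OF _ _ tendsto_const, rotated 2]) (auto intro!: always_eventually dist_triangle)
qed simp

text \<open>For fixed \<open>n\<close>, the points \<open>u j\<close> are asymptotically fixed by
  \<open>T ^^ Suc n\<close>, so the radius of \<open>(T ^^ Suc n) v\<close> is at most
  \<open>(1 + A n) * \<rho> + B n\<close>. The orbit of \<open>v\<close> is therefore minimising and
  converges to \<open>v\<close>.\<close>

lemma (in uniformly_convex_hyperbolic_space) asymptotic_center_fixed_point:
  assumes complete: "complete (UNIV :: 'a set)"
    and K: "closed K" "W_convex W K"
    and T: "nearly_nonexpansive K T A B" "uniformly_continuous_on K T"
    and AB: "\<And>n. 0 \<le> A n" "A \<longlonglongrightarrow> 0" "B \<longlonglongrightarrow> 0"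
    and u: "bounded (range u)" "\<And>j. u j \<in> K" "(\<lambda>j. dist (u j) (T (u j))) \<longlonglongrightarrow> 0"
    and v: "asymptotic_center K u = {v}"
  shows "T v = v"
proof -
  have TK: "T \<in> K \<rightarrow> K" and
    T_le: "\<And>u v n. u \<in> K \<Longrightarrow> v \<in> K \<Longrightarrow> dist ((T ^^ Suc n) u) ((T ^^ Suc n) v) \<le> (1 + A n) * dist u v + B n"
    using T(1) by (auto simp: nearly_nonexpansive_def)
  have "K \<noteq> {}"
    using u(2) by blast
  with v obtain \<rho> where \<rho>: "asymptotic_radius v u = ereal \<rho>" and lim:
    "\<And>w. \<lbrakk>\<And>n. w n \<in> K; \<And>e. 0 < e \<Longrightarrow> \<forall>\<^sub>F n in sequentially. asymptotic_radius (w n) u \<le> ereal (\<rho> + e)\<rbrakk>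
       \<Longrightarrow> w \<longlonglongrightarrow> v"
    using asymptotic_center_singleton[OF complete K _ u(1)] by (metis singleton_inject)
  have "v \<in> K"
    using v by (auto simp: asymptotic_center_def)
  have radius: "asymptotic_radius ((T ^^ Suc n) v) u \<le> ereal (\<rho> + (A n * \<rho> + B n))" for n
    unfolding asymptotic_radius_le_iff
  proof safe
    fix e :: real
    assume "0 < e"
    \<comment> \<open>Chosen so that the errors \<open>(1 + A n) * e'\<close> and \<open>e'\<close>
      of the estimate below add up to \<open>e\<close>.\<close>
    define e' where "e' = e / (2 + A n)"
    have "0 < 2 + A n"
      using AB(1)[of n] by simp
    then have "0 < e'" "(2 + A n) * e' = e"
      using \<open>0 < e\<close> by (auto simp: e'_def)
    then have e': "0 < e'" "(1 + A n) * e' + e' = e"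
      by (simp_all add: algebra_simps)
    have "\<forall>\<^sub>F j in sequentially. dist v (u j) < \<rho> + e'"
      using \<rho> e' asymptotic_radius_le_iff[of v u \<rho>] by auto
    moreover have "\<forall>\<^sub>F j in sequentially. dist (u j) ((T ^^ Suc n) (u j)) < e'"
      using order_tendstoD(2)[OF approximate_fixed_points_funpow[OF TK T(2) u(2,3)] e'(1)] .
    ultimately show "\<forall>\<^sub>F j in sequentially. dist ((T ^^ Suc n) v) (u j) < \<rho> + (A n * \<rho> + B n) + e"
    proof eventually_elim
      case (elim j)
      have "dist ((T ^^ Suc n) v) (u j)
        \<le> dist ((T ^^ Suc n) v) ((T ^^ Suc n) (u j)) + dist (u j) ((T ^^ Suc n) (u j))"
        by (rule dist_triangle2)
      also have "\<dots> < (1 + A n) * dist v (u j) + B n + e'"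
        using T_le[OF \<open>v \<in> K\<close> u(2)] elim(2) by (intro add_le_less_mono)
      also have "\<dots> \<le> (1 + A n) * (\<rho> + e') + B n + e'"
        using elim(1) AB(1)[of n] by (intro add_right_mono mult_left_mono) auto
      also have "\<dots> = \<rho> + (A n * \<rho> + B n) + ((1 + A n) * e' + e')"
        by (simp add: algebra_simps)
      finally show ?case
        unfolding e'(2) .
    qed
  qed
  have "(\<lambda>n. A n * \<rho> + B n) \<longlonglongrightarrow> 0 * \<rho> + 0"
    by (intro tendsto_intros AB)
  then have small: "\<forall>\<^sub>F n in sequentially. A n * \<rho> + B n < e" if "0 < e" for e
    using order_tendstoD(2)[of _ 0] that by simp
  have powers: "(\<lambda>n. (T ^^ Suc n) v) \<longlonglongrightarrow> v"
  proof (rule lim)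
    show "(T ^^ Suc n) v \<in> K" for n
      using TK \<open>v \<in> K\<close> by (rule funpow_in)
    fix e :: real
    assume "0 < e"
    from small[OF this]
    show "\<forall>\<^sub>F n in sequentially. asymptotic_radius ((T ^^ Suc n) v) u \<le> ereal (\<rho> + e)"
    proof eventually_elim
      case (elim n)
      then show ?case
        using radius[of n] by (auto intro: order_trans)
    qed
  qed
  have "continuous_on K T"
    using T(2) by (rule uniformly_continuous_imp_continuous)
  \<comment> \<open>Applying \<open>T\<close> only shifts the orbit, so \<open>T v\<close> and
    \<open>v\<close> are limits of the same sequence.\<close>
  then have "(\<lambda>n. T ((T ^^ Suc n) v)) \<longlonglongrightarrow> T v"
    using powers \<open>v \<in> K\<close> TK by (intro continuous_on_tendsto_compose[OF _ powers]) (auto intro!: always_eventually simp: Pi_iff funpow_in)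
  moreover have "(\<lambda>n. T ((T ^^ Suc n) v)) \<longlonglongrightarrow> v"
    using LIMSEQ_Suc[OF powers] by simp
  ultimately show ?thesis
    by (rule LIMSEQ_unique)
qed

text \<open>On \<open>F\<close> the radius does not change on passing to a subsequence, since the
  distances converge. Hence the center \<open>p\<close> of the whole sequence has radius no larger
  than the center \<open>v\<close> of a subsequence, also along that subsequence, and uniqueness
  gives \<open>p = v\<close>.\<close>

lemma (in uniformly_convex_hyperbolic_space) delta_converges_if_centers_in:
  assumes complete: "complete (UNIV :: 'a set)"
    and K: "closed K" "W_convex W K"
    and x: "range x \<subseteq> K" "bounded (range x)"
    and F: "\<And>p. p \<in> F \<Longrightarrow> convergent (\<lambda>n. dist (x n) p)"
    and centers: "\<And>s v. strict_mono s \<Longrightarrow> asymptotic_center K (x \<circ> s) = {v} \<Longrightarrow> v \<in> F"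
  shows "\<exists>p\<in>F. delta_converges K x p"
proof -
  have "K \<noteq> {}"
    using x(1) by blast
  have center: "\<exists>v. asymptotic_center K (x \<circ> s) = {v}" if "strict_mono s" for s
  proof -
    have "bounded (range (x \<circ> s))"
      using x(2) by (rule bounded_subset) auto
    then show ?thesis
      using asymptotic_center_singleton[OF complete K \<open>K \<noteq> {}\<close>] by metis
  qed
  have radius: "asymptotic_radius p (x \<circ> s) = asymptotic_radius p x" if "p \<in> F" "strict_mono s" for p s
  proof -
    obtain L where L: "(\<lambda>n. dist (x n) p) \<longlonglongrightarrow> L"
      using F[OF \<open>p \<in> F\<close>] by (auto simp: convergent_def)
    have "(\<lambda>n. ereal (dist p (x n))) \<longlonglongrightarrow> ereal L"
      using L by (simp add: dist_commute)
    then have "(\<lambda>n. ereal (dist p (x (s n)))) \<longlonglongrightarrow> ereal L" "(\<lambda>n. ereal (dist p (x n))) \<longlonglongrightarrow> ereal L"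
      using LIMSEQ_subseq_LIMSEQ[OF _ \<open>strict_mono s\<close>] by (force simp: o_def)+
    then show ?thesis
      unfolding asymptotic_radius_def by (simp add: lim_imp_Limsup del: tendsto_ereal lim_ereal)
  qed
  obtain p where p: "asymptotic_center K x = {p}"
    using center[OF strict_mono_id] by auto
  then have "p \<in> F"
    using centers[OF strict_mono_id] by simp
  have "asymptotic_center K (x \<circ> s) = {p}" if s: "strict_mono s" for s
  proof -
    obtain v where v: "asymptotic_center K (x \<circ> s) = {v}"
      using center[OF s] by blast
    then have "v \<in> F"
      using centers[OF s] by blast
    have K: "p \<in> K" "v \<in> K"
      using p v by (auto simp: asymptotic_center_def)
    have "asymptotic_radius p x \<le> asymptotic_radius v x"
      using p K by (auto simp: asymptotic_center_def)
    then have "asymptotic_radius p (x \<circ> s) \<le> asymptotic_radius v (x \<circ> s)"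
      using radius s \<open>p \<in> F\<close> \<open>v \<in> F\<close> by simp
    moreover have "\<And>y. y \<in> K \<Longrightarrow> asymptotic_radius v (x \<circ> s) \<le> asymptotic_radius y (x \<circ> s)"
      using v by (auto simp: asymptotic_center_def)
    ultimately have "p \<in> asymptotic_center K (x \<circ> s)"
      using K(1) by (auto simp: asymptotic_center_def intro: order_trans)
    then show ?thesis
      using v by simp
  qed
  then show ?thesis
    using x \<open>p \<in> F\<close> by (auto simp: delta_converges_def)
qed

section \<open>Distances along the multistep iteration\<close>

lemma real_tendsto_zero_bound:
  fixes f g :: "nat \<Rightarrow> real"
  assumes "g \<longlonglongrightarrow> 0" "\<And>n. 0 \<le> f n" "\<And>n. f n \<le> g n"
  shows "f \<longlonglongrightarrow> 0"
  by (rule tendsto_sandwich[OF _ _ tendsto_const assms(1)]) (use assms(2,3) in auto)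

text \<open>Setting \<open>Z n m = X n\<close> and \<open>X (Suc n) = Z n 0\<close> merges the cases \<open>m = 1\<close> and \<open>m \<ge> 2\<close> of the
  scheme; both the family of mappings and the iterates are indexed from 0 here.\<close>

locale multistep_iteration = uniformly_convex_hyperbolic_space W \<eta>
  for W :: "'a::metric_space \<Rightarrow> 'a \<Rightarrow> real \<Rightarrow> 'a" and \<eta> +
  fixes K :: "'a set" and m :: nat and S :: "nat \<Rightarrow> 'a \<Rightarrow> 'a"
    and A B \<alpha> :: "nat \<Rightarrow> real" and s :: real
    and X :: "nat \<Rightarrow> 'a" and Z :: "nat \<Rightarrow> nat \<Rightarrow> 'a"
  assumes K: "W_convex W K"
    and S: "\<And>i. i < m \<Longrightarrow> nearly_nonexpansive K (S i) A B"
      "\<And>i. i < m \<Longrightarrow> uniformly_continuous_on K (S i)"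
    and AB: "\<And>n. 0 \<le> A n" "\<And>n. 0 \<le> B n" "summable A" "summable B"
    and s: "0 < s" "s \<le> 1/2" "\<And>n. \<alpha> n \<in> {s..1 - s}"
    and X_0: "X 0 \<in> K"
    and X_Suc: "\<And>n. X (Suc n) = Z n 0"
    and Z_last: "\<And>n. Z n m = X n"
    and Z_step: "\<And>n j. j < m \<Longrightarrow> Z n j = W (X n) ((S j ^^ Suc n) (Z n (Suc j))) (\<alpha> n)"
begin

lemma \<alpha>_in: "\<alpha> n \<in> {0..1}"
  using s(3)[of n] s(1) by auto

lemma S_in: "i < m \<Longrightarrow> S i \<in> K \<rightarrow> K"
  using S(1) by (simp add: nearly_nonexpansive_def)

lemma S_power_in: "i < m \<Longrightarrow> u \<in> K \<Longrightarrow> (S i ^^ n) u \<in> K"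
  using S_in funpow_in by metis

lemma dist_S_power_le:
  "i < m \<Longrightarrow> u \<in> K \<Longrightarrow> v \<in> K \<Longrightarrow> dist ((S i ^^ Suc n) u) ((S i ^^ Suc n) v) \<le> (1 + A n) * dist u v + B n"
  using S(1) unfolding nearly_nonexpansive_def by blast

lemma A_tendsto: "A \<longlonglongrightarrow> 0" and B_tendsto: "B \<longlonglongrightarrow> 0"
  using AB summable_LIMSEQ_zero by auto

text \<open>Downward induction from \<open>Z n m = X n\<close>, because \<open>Z n j\<close> is
  computed from \<open>Z n (Suc j)\<close>. The premise on \<open>X n\<close> is then removed by
  induction on \<open>n\<close> in \<open>X_in\<close>.\<close>

lemma Z_in_if:
  assumes "X n \<in> K" "j \<le> m"
  shows "Z n j \<in> K"
  using assms(2)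
proof (induction rule: inc_induct)
  case base
  then show ?case
    using assms(1) by (simp add: Z_last)
next
  case (step j)
  then have "(S j ^^ Suc n) (Z n (Suc j)) \<in> K"
    using S_power_in by blast
  then show ?case
    using step(2) assms(1) K \<alpha>_in[of n] by (simp add: Z_step W_convex_def)
qed

lemma X_in: "X n \<in> K"
  by (induction n) (auto simp: X_0 X_Suc Z_in_if)

lemma Z_in: "j \<le> m \<Longrightarrow> Z n j \<in> K"
  using Z_in_if X_in by blast

context
  fixes p
  assumes p: "p \<in> K" "\<And>i. i < m \<Longrightarrow> S i p = p"
begin

lemma dist_S_power_fixed_le:
  assumes "i < m" "u \<in> K"
  shows "dist ((S i ^^ Suc n) u) p \<le> (1 + A n) * dist u p + B n"
proof -
  have "(S i ^^ n) p = p" for n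
    by (induction n) (simp_all add: p(2) assms(1))
  then show ?thesis
    using dist_S_power_le[OF assms p(1), of n] by metis
qed

lemma dist_Z_step_le:
  assumes "j < m"
  shows "dist (Z n j) p \<le> (1 - \<alpha> n) * dist (X n) p + \<alpha> n * ((1 + A n) * dist (Z n (Suc j)) p + B n)"
proof -
  have "dist p (Z n j) \<le> (1 - \<alpha> n) * dist p (X n) + \<alpha> n * dist p ((S j ^^ Suc n) (Z n (Suc j)))"
    unfolding Z_step[OF assms] by (rule W1[OF \<alpha>_in])
  also have "\<dots> \<le> (1 - \<alpha> n) * dist p (X n) + \<alpha> n * ((1 + A n) * dist (Z n (Suc j)) p + B n)"
    using dist_S_power_fixed_le[OF assms Z_in] assms \<alpha>_in[of n]
    by (intro add_left_mono mult_left_mono) (auto simp: dist_commute)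
  finally show ?thesis
    by (simp add: dist_commute)
qed

text \<open>Downward induction on \<open>j\<close>: each step multiplies by one more factor
  \<open>1 + A n\<close>, which a larger constant absorbs because \<open>A\<close> is
  bounded.\<close>

lemma dist_Z_le:
  assumes "j \<le> m"
  shows "\<exists>C\<ge>0. \<forall>n. dist (Z n j) p \<le> (1 + C * A n) * dist (X n) p + C * B n"
  using assms
proof (induction rule: inc_induct)
  case base
  show ?case
    by (rule exI[of _ 0]) (simp add: Z_last)
next
  case (step j)
  then obtain C where "0 \<le> C" and C: "\<And>n. dist (Z n (Suc j)) p \<le> (1 + C * A n) * dist (X n) p + C * B n"
    by blast
  obtain a where a: "0 < a" "\<And>n. A n \<le> a"
    using A_tendsto[THEN convergentI, THEN convergent_imp_Bseq] AB(1) by (auto elim: BseqE)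
  \<comment> \<open>Dominates the coefficient in
    \<open>(1 + A n) * (1 + C * A n) = 1 + (C * (1 + A n) + 1) * A n\<close>, as
    \<open>A n \<le> a\<close>.\<close>
  define C' where "C' = C * (1 + a) + 1"
  have C': "0 \<le> C'"
    using \<open>0 \<le> C\<close> a(1) by (simp add: C'_def)
  have "dist (Z n j) p \<le> (1 + C' * A n) * dist (X n) p + C' * B n" for n
  proof -
    have le: "C * (1 + A n) + 1 \<le> C'"
      unfolding C'_def using a(2)[of n] \<open>0 \<le> C\<close> by (simp add: mult_left_mono)
    have "(1 + A n) * dist (Z n (Suc j)) p + B n
        \<le> (1 + A n) * ((1 + C * A n) * dist (X n) p + C * B n) + B n"
      using C AB(1)[of n] by (intro add_right_mono mult_left_mono) auto
    also have "\<dots> = (1 + (C * (1 + A n) + 1) * A n) * dist (X n) p + (C * (1 + A n) + 1) * B n"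
      by (simp add: algebra_simps)
    also have "\<dots> \<le> (1 + C' * A n) * dist (X n) p + C' * B n"
      using le AB(1,2)[of n] by (intro add_mono mult_right_mono) auto
    finally have 1: "(1 + A n) * dist (Z n (Suc j)) p + B n \<le> (1 + C' * A n) * dist (X n) p + C' * B n" .
    \<comment> \<open>The bound also dominates \<open>dist (X n) p\<close>, so the convex
      combination with weight \<open>1 - \<alpha> n\<close> on that term respects it.\<close>
    have "1 * dist (X n) p \<le> (1 + C' * A n) * dist (X n) p"
      using C' AB(1)[of n] by (intro mult_right_mono) auto
    then have 2: "dist (X n) p \<le> (1 + C' * A n) * dist (X n) p + C' * B n"
      using C' AB(2)[of n] by (simp add: add_increasing2)
    show ?thesis
      using dist_Z_step_le[OF step(2), of n] convex_bound_le[OF 2 1, of "1 - \<alpha> n" "\<alpha> n"] \<alpha>_in[of n]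
      by simp
  qed
  then show ?case
    using C' by blast
qed

text \<open>Since \<open>X (Suc n) = Z n 0\<close>, the case \<open>j = 0\<close> of
  \<open>dist_Z_le\<close> is a summably perturbed recursion.\<close>

lemma convergent_dist: "convergent (\<lambda>n. dist (X n) p)"
proof -
  obtain C where "0 \<le> C" "\<And>n. dist (Z n 0) p \<le> (1 + C * A n) * dist (X n) p + C * B n"
    using dist_Z_le[of 0] by auto
  then show ?thesis
    using AB by (intro perturbed_recursion_convergent[of _ "\<lambda>n. C * A n" "\<lambda>n. C * B n"])
      (auto simp: X_Suc summable_mult)
qed

lemma dist_Z_upper:
  assumes c: "(\<lambda>n. dist (X n) p) \<longlonglongrightarrow> c" and "j \<le> m"
  obtains U where "U \<longlonglongrightarrow> c" "\<And>n. dist (Z n j) p \<le> U n"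
proof -
  obtain C where C: "\<And>n. dist (Z n j) p \<le> (1 + C * A n) * dist (X n) p + C * B n"
    using dist_Z_le[OF \<open>j \<le> m\<close>] by blast
  have "(\<lambda>n. (1 + C * A n) * dist (X n) p + C * B n) \<longlonglongrightarrow> (1 + C * 0) * c + C * 0"
    by (intro tendsto_intros A_tendsto B_tendsto c)
  then show ?thesis
    using that C by simp
qed

text \<open>This induction runs upwards, starting from \<open>Z n 0 = X (Suc n)\<close>. The upper
  bound is \<open>dist_Z_upper\<close>; the lower one comes from solving
  \<open>dist_Z_step_le\<close> for \<open>dist (Z n (Suc j)) p\<close>, where \<alpha> being
  bounded away from 0 permits the division.\<close>

lemma dist_Z_tendsto:
  assumes c: "(\<lambda>n. dist (X n) p) \<longlonglongrightarrow> c" and "j \<le> m"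
  shows "(\<lambda>n. dist (Z n j) p) \<longlonglongrightarrow> c"
  using assms(2)
proof (induction j)
  case 0
  then show ?case
    using LIMSEQ_Suc[OF c] by (simp add: X_Suc)
next
  case (Suc j)
  obtain U where U: "U \<longlonglongrightarrow> c" "\<And>n. dist (Z n (Suc j)) p \<le> U n"
    using dist_Z_upper[OF c Suc.prems] by blast
  \<comment> \<open>The solved form of \<open>dist_Z_step_le\<close>, with \<open>\<alpha> n\<close>
    replaced by its lower bound \<open>s\<close> and the distance multiplied by \<open>A n\<close>
    replaced by its upper bound \<open>U n\<close>.\<close>
  define L where "L n = dist (X n) p - \<bar>dist (Z n j) p - dist (X n) p\<bar> / s - A n * U n - B n" for n
  have "L \<longlonglongrightarrow> c - \<bar>c - c\<bar> / s - 0 * c - 0"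
    unfolding L_def using s(1) Suc by (intro tendsto_intros A_tendsto B_tendsto c U) auto
  then have "L \<longlonglongrightarrow> c"
    by simp
  have L_le: "L n \<le> dist (Z n (Suc j)) p" for n
  proof -
    define D E where "D = dist (X n) p" and "E = (1 + A n) * dist (Z n (Suc j)) p + B n"
    have "dist (Z n j) p \<le> (1 - \<alpha> n) * D + \<alpha> n * E"
      using dist_Z_step_le[of j n] Suc.prems by (simp add: D_def E_def)
    then have *: "\<alpha> n * (D - E) \<le> \<bar>dist (Z n j) p - D\<bar>"
      by (simp add: algebra_simps)
    have "D - E \<le> \<bar>dist (Z n j) p - D\<bar> / s"
    \<comment> \<open>Replacing \<open>\<alpha> n\<close> by \<open>s\<close> requires
      \<open>D - E\<close> to be positive; otherwise the bound is trivial.\<close>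
    proof (cases "D \<le> E")
      case False
      then have "s * (D - E) \<le> \<alpha> n * (D - E)"
        using s(3)[of n] by (intro mult_right_mono) auto
      with * s(1) show ?thesis
        by (simp add: field_simps)
    qed (use s(1) in \<open>auto intro: order_trans[of _ 0]\<close>)
    moreover have "E \<le> dist (Z n (Suc j)) p + A n * U n + B n"
      using mult_left_mono[OF U(2) AB(1), of n n] by (simp add: E_def algebra_simps)
    ultimately show ?thesis
      by (simp add: L_def D_def)
  qed
  show ?case
    by (rule tendsto_sandwich[OF _ _ \<open>L \<longlonglongrightarrow> c\<close> U(1)]) (simp_all add: L_le U(2))
qed

text \<open>\<open>Z n j\<close> is the \<open>W\<close>-combination of the two points, and its
  distance to \<open>p\<close> has the same limit as that of \<open>X n\<close>, so
  \<open>dist_tendsto_zero_of_W_tendsto\<close> applies.\<close>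

lemma dist_X_S_power_Z_tendsto:
  assumes "j < m"
  shows "(\<lambda>n. dist (X n) ((S j ^^ Suc n) (Z n (Suc j)))) \<longlonglongrightarrow> 0"
proof -
  obtain c where c: "(\<lambda>n. dist (X n) p) \<longlonglongrightarrow> c"
    using convergent_dist by (auto simp: convergent_def)
  have "(\<lambda>n. (1 + A n) * dist (Z n (Suc j)) p + B n) \<longlonglongrightarrow> (1 + 0) * c + 0"
    using assms by (intro tendsto_intros A_tendsto B_tendsto dist_Z_tendsto c) auto
  then have "(\<lambda>n. (1 + A n) * dist (Z n (Suc j)) p + B n) \<longlonglongrightarrow> c"
    by simp
  moreover have "dist ((S j ^^ Suc n) (Z n (Suc j))) p \<le> (1 + A n) * dist (Z n (Suc j)) p + B n" for n
    using dist_S_power_fixed_le[OF assms Z_in] assms by simp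
  moreover have "(\<lambda>n. dist (W (X n) ((S j ^^ Suc n) (Z n (Suc j))) (\<alpha> n)) p) \<longlonglongrightarrow> c"
    using dist_Z_tendsto[OF c, of j] assms by (simp only: Z_step less_imp_le)
  ultimately show ?thesis
    using c s by (intro dist_tendsto_zero_of_W_tendsto) auto
qed

text \<open>For \<open>j < m\<close>, \<open>Z n j\<close> lies on a segment issuing from
  \<open>X n\<close> whose length tends to 0.\<close>

lemma dist_X_Z_tendsto:
  assumes "j \<le> m"
  shows "(\<lambda>n. dist (X n) (Z n j)) \<longlonglongrightarrow> 0"
proof (cases "j < m")
  case True
  show ?thesis
  proof (rule real_tendsto_zero_bound[OF dist_X_S_power_Z_tendsto[OF True]])
    fix n
    have "dist (X n) (Z n j) \<le> \<alpha> n * dist (X n) ((S j ^^ Suc n) (Z n (Suc j)))"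
      unfolding Z_step[OF True] by (rule dist_W_left[OF \<alpha>_in])
    also have "\<dots> \<le> 1 * dist (X n) ((S j ^^ Suc n) (Z n (Suc j)))"
      using \<alpha>_in[of n] by (intro mult_right_mono) auto
    finally show "dist (X n) (Z n j) \<le> dist (X n) ((S j ^^ Suc n) (Z n (Suc j)))"
      by simp
  qed simp
next
  case False
  then show ?thesis
    using assms by (simp add: Z_last)
qed

lemma dist_X_X_Suc_tendsto: "(\<lambda>n. dist (X n) (X (Suc n))) \<longlonglongrightarrow> 0"
  using dist_X_Z_tendsto[of 0] by (simp add: X_Suc)

lemma dist_X_S_power_X_tendsto:
  assumes "i < m"
  shows "(\<lambda>n. dist (X n) ((S i ^^ Suc n) (X n))) \<longlonglongrightarrow> 0"
proof (rule real_tendsto_zero_bound)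
  have "(\<lambda>n. dist (X n) ((S i ^^ Suc n) (Z n (Suc i))) + ((1 + A n) * dist (X n) (Z n (Suc i)) + B n))
      \<longlonglongrightarrow> 0 + ((1 + 0) * 0 + 0)"
    using assms
    by (intro tendsto_add tendsto_mult tendsto_const A_tendsto B_tendsto dist_X_S_power_Z_tendsto dist_X_Z_tendsto) auto
  then show "(\<lambda>n. dist (X n) ((S i ^^ Suc n) (Z n (Suc i))) + ((1 + A n) * dist (X n) (Z n (Suc i)) + B n)) \<longlonglongrightarrow> 0"
    by simp
  fix n
  have "dist (X n) ((S i ^^ Suc n) (X n)) \<le> dist (X n) ((S i ^^ Suc n) (Z n (Suc i)))
      + dist ((S i ^^ Suc n) (X n)) ((S i ^^ Suc n) (Z n (Suc i)))"
    by (rule dist_triangle2)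
  also have "\<dots> \<le> dist (X n) ((S i ^^ Suc n) (Z n (Suc i))) + ((1 + A n) * dist (X n) (Z n (Suc i)) + B n)"
    using dist_S_power_le[OF assms X_in Z_in] assms by simp
  finally show "dist (X n) ((S i ^^ Suc n) (X n))
      \<le> dist (X n) ((S i ^^ Suc n) (Z n (Suc i))) + ((1 + A n) * dist (X n) (Z n (Suc i)) + B n)" .
qed simp

text \<open>Compares powers at \<open>X (Suc n)\<close>: the power \<open>Suc n\<close> moves it
  little, because consecutive iterates approach each other. Uniform continuity then brings the power
  \<open>Suc (Suc n)\<close> close to the first power, and the former also moves it little.\<close>

lemma dist_X_S_X_tendsto:
  assumes "i < m"
  shows "(\<lambda>n. dist (X n) (S i (X n))) \<longlonglongrightarrow> 0"
proof -
  let ?u = "\<lambda>n. (S i ^^ Suc n) (X (Suc n))"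
  have "(\<lambda>n. dist (?u n) (X (Suc n))) \<longlonglongrightarrow> 0"
  proof (rule real_tendsto_zero_bound)
    let ?b = "\<lambda>n. ((1 + A n) * dist (X n) (X (Suc n)) + B n)
      + (dist (X n) ((S i ^^ Suc n) (X n)) + dist (X n) (X (Suc n)))"
    have "?b \<longlonglongrightarrow> ((1 + 0) * 0 + 0) + (0 + 0)"
      by (intro tendsto_add tendsto_mult tendsto_const A_tendsto B_tendsto
          dist_X_S_power_X_tendsto assms dist_X_X_Suc_tendsto)
    then show "?b \<longlonglongrightarrow> 0"
      by simp
    fix n
    show "dist (?u n) (X (Suc n)) \<le> ?b n"
      using dist_S_power_le[OF assms X_in X_in, of n n "Suc n"]
        dist_triangle3[of "?u n" "X (Suc n)" "(S i ^^ Suc n) (X n)"]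
        dist_triangle3[of "(S i ^^ Suc n) (X n)" "X (Suc n)" "X n"]
      by linarith
  qed simp
  then have "(\<lambda>n. dist (S i (?u n)) (S i (X (Suc n)))) \<longlonglongrightarrow> 0"
    using S(2)[OF assms, unfolded uniformly_continuous_on_sequentially, rule_format, of ?u "\<lambda>n. X (Suc n)"]
      X_in S_power_in[OF assms] by blast
  from tendsto_add[OF LIMSEQ_Suc[OF dist_X_S_power_X_tendsto[OF assms]] this]
  have "(\<lambda>n. dist (X (Suc n)) ((S i ^^ Suc (Suc n)) (X (Suc n))) + dist (S i (?u n)) (S i (X (Suc n)))) \<longlonglongrightarrow> 0"
    by simp
  then have "(\<lambda>n. dist (X (Suc n)) (S i (X (Suc n)))) \<longlonglongrightarrow> 0"
    by (rule real_tendsto_zero_bound) (auto intro: dist_triangle)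
  then show ?thesis
    by (rule LIMSEQ_imp_Suc)
qed

end

lemma delta_convergence:
  assumes complete: "complete (UNIV :: 'a set)" and closed: "closed K"
    and "0 < m" and nonempty: "(\<Inter>i<m. fixed_points K (S i)) \<noteq> {}"
  shows "\<exists>p \<in> (\<Inter>i<m. fixed_points K (S i)). delta_converges K X p"
proof (rule delta_converges_if_centers_in[OF complete closed K])
  \<comment> \<open>An intersection over no indices would be the whole type; \<open>0 < m\<close>
    places \<open>p\<close> in \<open>K\<close>.\<close>
  have fixed: "p \<in> K" "\<And>i. i < m \<Longrightarrow> S i p = p" if "p \<in> (\<Inter>i<m. fixed_points K (S i))" for p
    using that \<open>0 < m\<close> by (auto simp: fixed_points_def)
  \<comment> \<open>A single common fixed point yields both the boundedness of \<open>X\<close> and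
    \<open>dist_X_S_X_tendsto\<close>.\<close>
  obtain q where q: "q \<in> (\<Inter>i<m. fixed_points K (S i))"
    using nonempty by blast
  show "range X \<subseteq> K"
    using X_in by blast
  show conv: "convergent (\<lambda>n. dist (X n) p)" if "p \<in> (\<Inter>i<m. fixed_points K (S i))" for p
    using convergent_dist fixed[OF that] by blast
  obtain R where "\<And>n. dist (X n) q \<le> R"
    using convergent_imp_Bseq[OF conv[OF q]] by (auto simp: Bseq_def)
  then show bounded: "bounded (range X)"
    unfolding bounded_def by (metis dist_commute rangeE)
  fix r :: "nat \<Rightarrow> nat" and v
  assume r: "strict_mono r" and v: "asymptotic_center K (X \<circ> r) = {v}"
  have "S i v = v" if "i < m" for i
  proof (rule asymptotic_center_fixed_point[OF complete closed K S[OF that] AB(1) A_tendsto B_tendsto _ _ _ v])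
    show "bounded (range (X \<circ> r))"
      using bounded by (rule bounded_subset) auto
    show "(X \<circ> r) j \<in> K" for j
      by (simp add: X_in)
    show "(\<lambda>j. dist ((X \<circ> r) j) (S i ((X \<circ> r) j))) \<longlonglongrightarrow> 0"
      using LIMSEQ_subseq_LIMSEQ[OF dist_X_S_X_tendsto[OF fixed[OF q] that] r] by (simp add: o_def)
  qed
  moreover have "v \<in> K"
    using v by (auto simp: asymptotic_center_def)
  ultimately show "v \<in> (\<Inter>i<m. fixed_points K (S i))"
    by (auto simp: fixed_points_def)
qed

end

section \<open>Reduction of the given family and scheme to the multistep iteration\<close>

text \<open>Above \<open>M\<close> the function \<xi> is linearly bounded, and below
  \<open>M\<close> monotonicity bounds it by \<open>\<xi> M\<close>; so
  \<open>\<xi> t \<le> M' * t + \<xi> M\<close> for all \<open>t \<ge> 0\<close>.\<close>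

lemma total_asymptotically_nonexpansive_imp_nearly:
  assumes T: "total_asymptotically_nonexpansive K T k \<phi> \<xi>"
    and M: "0 < M" "0 < M'" "\<And>t. M \<le> t \<Longrightarrow> \<xi> t \<le> M' * t"
  shows "nearly_nonexpansive K T (\<lambda>n. k (Suc n) * M') (\<lambda>n. k (Suc n) * \<xi> M + \<phi> (Suc n))"
proof -
  have \<xi>: "strict_mono_on {0..} \<xi>" "\<xi> \<in> {0..} \<rightarrow> {0..}"
    using T by (auto simp: total_asymptotically_nonexpansive_def)
  have T_le: "dist ((T ^^ n) u) ((T ^^ n) v) \<le> dist u v + k n * \<xi> (dist u v) + \<phi> n"
    if "u \<in> K" "v \<in> K" "1 \<le> n" for u v n
    using T that unfolding total_asymptotically_nonexpansive_def by blast
  have \<xi>_le: "\<xi> t \<le> M' * t + \<xi> M" if "0 \<le> t" for t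
  proof (cases "M \<le> t")
    case True
    have "0 \<le> \<xi> M"
      using \<xi>(2) M(1) by auto
    then show ?thesis
      using M(3)[OF True] by simp
  next
    case False
    have "\<xi> t \<le> \<xi> M"
      using strict_mono_onD[OF \<xi>(1), of t M] that False by simp
    then show ?thesis
      using that M(2) by (simp add: add_increasing)
  qed
  have "dist ((T ^^ Suc n) u) ((T ^^ Suc n) v)
      \<le> (1 + k (Suc n) * M') * dist u v + (k (Suc n) * \<xi> M + \<phi> (Suc n))" if "u \<in> K" "v \<in> K" for u v n
  proof -
    have "dist ((T ^^ Suc n) u) ((T ^^ Suc n) v) \<le> dist u v + k (Suc n) * \<xi> (dist u v) + \<phi> (Suc n)"
      by (rule T_le[OF that]) simp
    also have "\<dots> \<le> dist u v + k (Suc n) * (M' * dist u v + \<xi> M) + \<phi> (Suc n)"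
      using T \<xi>_le by (intro add_mono mult_left_mono) (auto simp: total_asymptotically_nonexpansive_def)
    finally show ?thesis
      by (simp add: algebra_simps)
  qed
  then show ?thesis
    using T by (simp add: nearly_nonexpansive_def total_asymptotically_nonexpansive_def)
qed

text \<open>Allows a common pair of error sequences for the whole family.\<close>

lemma nearly_nonexpansive_mono:
  assumes "nearly_nonexpansive K T A B" "\<And>n. A n \<le> A' n" "\<And>n. B n \<le> B' n"
  shows "nearly_nonexpansive K T A' B'"
proof -
  have "(1 + A n) * dist u v + B n \<le> (1 + A' n) * dist u v + B' n" for u v :: 'a and n
    using assms by (intro add_mono mult_right_mono) auto
  then show ?thesis
    using assms(1) unfolding nearly_nonexpansive_def by (meson order_trans)
qed

theorem theorem3p3:
  fixes W :: "'a::metric_space \<Rightarrow> 'a \<Rightarrow> real \<Rightarrow> 'a"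
    and \<eta> :: "real \<Rightarrow> real \<Rightarrow> real"
    and K :: "'a set"
    and m :: nat
    and T :: "nat \<Rightarrow> 'a \<Rightarrow> 'a"
    and k \<phi> :: "nat \<Rightarrow> nat \<Rightarrow> real"
    and \<xi> :: "nat \<Rightarrow> real \<Rightarrow> real"
    and \<alpha> :: "nat \<Rightarrow> real"
    and x :: "nat \<Rightarrow> 'a"
    and y :: "nat \<Rightarrow> nat \<Rightarrow> 'a"
  assumes "hyperbolic_space W"
    and "complete (UNIV :: 'a set)"
    and "uniformly_convex W"
    and "modulus_of_uniform_convexity W \<eta>"
    and "monotone_modulus \<eta>"
    and "K \<noteq> {}" and "closed K" and "W_convex W K"
    and "m \<ge> 1"
    and "\<And>i. i \<in> {1..m} \<Longrightarrow> uniformly_continuous_on K (T i)"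
    and "\<And>i. i \<in> {1..m} \<Longrightarrow> total_asymptotically_nonexpansive K (T i) (k i) (\<phi> i) (\<xi> i)"
    and "(\<Inter>i\<in>{1..m}. fixed_points K (T i)) \<noteq> {}"
    and C1: "\<And>i. i \<in> {1..m} \<Longrightarrow>
      summable (\<lambda>n. k i (n + 1)) \<and> summable (\<lambda>n. \<phi> i (n + 1))"
    and C2: "\<And>i. i \<in> {1..m} \<Longrightarrow>
      \<exists>M>0. \<exists>M'>0. \<forall>t\<ge>M. \<xi> i t \<le> M' * t"
    and "\<And>n. n \<ge> 1 \<Longrightarrow> \<alpha> n \<in> {0..1}"
    and "\<exists>a\<in>{0<..<1}. \<exists>b\<in>{0<..<1}. \<forall>n\<ge>1. \<alpha> n \<in> {a..b}"
    and "x 1 \<in> K"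
    and "iteration_scheme W m T \<alpha> x y"
  shows "\<exists>p \<in> (\<Inter>i\<in>{1..m}. fixed_points K (T i)). delta_converges K (\<lambda>n. x (n + 1)) p"
proof -
  obtain M M' where M: "\<And>i. i \<in> {1..m} \<Longrightarrow> 0 < M i" "\<And>i. i \<in> {1..m} \<Longrightarrow> 0 < M' i"
      "\<And>i t. i \<in> {1..m} \<Longrightarrow> M i \<le> t \<Longrightarrow> \<xi> i t \<le> M' i * t"
    using C2 by metis
  obtain a b where ab: "0 < a" "b < 1" "\<And>n. 1 \<le> n \<Longrightarrow> \<alpha> n \<in> {a..b}"
    using assms(16) by auto
  \<comment> \<open>Makes \<open>{s..1 - s}\<close> a symmetric interval containing
    \<open>{a..b}\<close>, as the estimates with exchanged end points require.\<close>
  define s where "s = min (1/2) (min a (1 - b))"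
  have s: "0 < s" "s \<le> 1/2" "s \<le> a" "s \<le> 1 - b"
    unfolding s_def using ab(1,2) by linarith+
  \<comment> \<open>Sums over the family dominate the errors of each mapping, all terms being
    nonnegative, and remain summable.\<close>
  define A B where "A n = (\<Sum>i=1..m. k i (Suc n) * M' i)"
    and "B n = (\<Sum>i=1..m. k i (Suc n) * \<xi> i (M i) + \<phi> i (Suc n))" for n
  \<comment> \<open>The outer values encode \<open>X n\<close> at \<open>j = m\<close> and the next
    iterate at \<open>j = 0\<close>; the given \<open>y\<close> fills the range between. The step
    \<open>n\<close> here is step \<open>Suc n\<close> of the scheme.\<close>
  define Z where "Z n j = (if j = m then x (Suc n) else if j = 0 then x (Suc (Suc n)) else y j (Suc n))" for n j
  have nonneg: "0 \<le> k i (Suc n) * M' i" "0 \<le> k i (Suc n) * \<xi> i (M i) + \<phi> i (Suc n)" if "i \<in> {1..m}" for i n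
    using assms(11)[OF that] M(1,2)[OF that] by (auto simp: total_asymptotically_nonexpansive_def Pi_iff)
  have scheme: "m = 1 \<Longrightarrow> x (Suc (Suc n)) = W (x (Suc n)) ((T 1 ^^ Suc n) (x (Suc n))) (\<alpha> (Suc n))"
    "2 \<le> m \<Longrightarrow> x (Suc (Suc n)) = W (x (Suc n)) ((T 1 ^^ Suc n) (y 1 (Suc n))) (\<alpha> (Suc n))"
    "2 \<le> m \<Longrightarrow> 1 \<le> j \<Longrightarrow> j \<le> m - 2 \<Longrightarrow>
       y j (Suc n) = W (x (Suc n)) ((T (Suc j) ^^ Suc n) (y (Suc j) (Suc n))) (\<alpha> (Suc n))"
    "2 \<le> m \<Longrightarrow> y (m - 1) (Suc n) = W (x (Suc n)) ((T m ^^ Suc n) (x (Suc n))) (\<alpha> (Suc n))" for n j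
    using assms(18) unfolding iteration_scheme_def by (simp_all del: funpow.simps)
  have Z_step: "Z n j = W (x (Suc n)) ((T (Suc j) ^^ Suc n) (Z n (Suc j))) (\<alpha> (Suc n))" if "j < m" for n j
  proof -
    \<comment> \<open>One case per formula of the scheme: single mapping, outermost step,
      intermediate step, innermost step. For \<open>m = 2\<close> the intermediate range is
      empty.\<close>
    have "m = 1 \<and> j = 0 \<or> 2 \<le> m \<and> j = 0 \<or> 2 \<le> m \<and> 1 \<le> j \<and> j \<le> m - 2 \<or> 2 \<le> m \<and> j = m - 1"
      using that by arith
    then consider "m = 1" "j = 0" | "2 \<le> m" "j = 0" | "2 \<le> m" "1 \<le> j" "j \<le> m - 2"
      | "2 \<le> m" "j = m - 1"
      by blast
    then show ?thesis
    proof cases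
      case 1
      then have "Z n j = x (Suc (Suc n))" "Z n (Suc j) = x (Suc n)" "Suc j = 1"
        by (simp_all add: Z_def)
      then show ?thesis
        using scheme(1)[OF 1(1), of n] by metis
    next
      case 2
      then have "Z n j = x (Suc (Suc n))" "Z n (Suc j) = y 1 (Suc n)" "Suc j = 1"
        by (auto simp: Z_def)
      then show ?thesis
        using scheme(2)[OF 2(1), of n] by metis
    next
      case 3
      then have "Z n j = y j (Suc n)" "Z n (Suc j) = y (Suc j) (Suc n)"
        by (auto simp: Z_def)
      then show ?thesis
        using scheme(3)[OF 3, of n] by metis
    next
      case 4
      then have "Z n j = y (m - 1) (Suc n)" "Z n (Suc j) = x (Suc n)" "Suc j = m"
        by (auto simp: Z_def)
      then show ?thesis
        using scheme(4)[OF 4(1), of n] by metis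
    qed
  qed
  interpret hyperbolic_space W by fact
  interpret multistep_iteration W \<eta> K m "\<lambda>i. T (Suc i)" A B "\<lambda>n. \<alpha> (Suc n)" s "\<lambda>n. x (Suc n)" Z
  proof
    show "nearly_nonexpansive K (T (Suc i)) A B" if "i < m" for i
    proof (rule nearly_nonexpansive_mono)
      have i: "Suc i \<in> {1..m}"
        using that by simp
      show "nearly_nonexpansive K (T (Suc i)) (\<lambda>n. k (Suc i) (Suc n) * M' (Suc i))
          (\<lambda>n. k (Suc i) (Suc n) * \<xi> (Suc i) (M (Suc i)) + \<phi> (Suc i) (Suc n))"
        using assms(11)[OF i] M[OF i] by (rule total_asymptotically_nonexpansive_imp_nearly)
      show "k (Suc i) (Suc n) * M' (Suc i) \<le> A n" for n
        unfolding A_def using nonneg(1) i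
        by (intro member_le_sum[where f = "\<lambda>i. k i (Suc n) * M' i"]) auto
      show "k (Suc i) (Suc n) * \<xi> (Suc i) (M (Suc i)) + \<phi> (Suc i) (Suc n) \<le> B n" for n
        unfolding B_def using nonneg(2) i
        by (intro member_le_sum[where f = "\<lambda>i. k i (Suc n) * \<xi> i (M i) + \<phi> i (Suc n)"]) auto
    qed
    show "uniformly_continuous_on K (T (Suc i))" if "i < m" for i
      using assms(10) that by simp
    show "0 \<le> A n" "0 \<le> B n" for n
      unfolding A_def B_def by (rule sum_nonneg, rule nonneg, simp)+
    show "summable A" "summable B"
      unfolding A_def B_def using C1 by (auto intro!: summable_sum summable_add summable_mult2)
    show "0 < s" "s \<le> 1/2"
      by fact+
    show "\<alpha> (Suc n) \<in> {s..1 - s}" for n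
      using ab(3)[of "Suc n"] s(3,4) by simp
    show "Z n j = W (x (Suc n)) ((T (Suc j) ^^ Suc n) (Z n (Suc j))) (\<alpha> (Suc n))" if "j < m" for n j
      using that by (rule Z_step)
    show "x (Suc (Suc n)) = Z n 0" for n
      using \<open>m \<ge> 1\<close> by (simp add: Z_def)
    show "Z n m = x (Suc n)" for n
      by (simp add: Z_def)
    show "modulus_of_uniform_convexity W \<eta>" "monotone_modulus \<eta>" "W_convex W K"
      by fact+
    show "x (Suc 0) \<in> K"
      using assms(17) by simp
  qed
  have "(\<Inter>i<m. fixed_points K (T (Suc i))) = (\<Inter>i\<in>{1..m}. fixed_points K (T i))"
    using image_Suc_lessThan[of m] by (metis image_image)
  then show ?thesis
    using delta_convergence[OF assms(2,7)] assms(9,12) by simp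
qed

end
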